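(* Let $A\in\mathbb{R}^{m\times n}$, $M\in\mathbb{R}^{q\times m}$, $L\in\mathbb{R}^{p\times n}$, and let $P=M^{\top}M$, $Q=L^{\top}L$, $G=A^{\top}PA+Q$. Let $A_{ML}^{\dagger}$ be the $ML$-weighted pseudoinverse of $A$, and let $\mathcal{A}:(\mathcal{R}(G),\langle\cdot,\cdot\rangle_{G})\to(\mathcal{R}(P),\langle\cdot,\cdot\rangle_{P})$ be the linear operator $\mathcal{A}v=\mathcal{P}_{\mathcal{R}(P)}Av$. Then, under the canonical bases of $\mathbb{R}^n$ and $\mathbb{R}^m$, $$A_{ML}^{\dagger}=\mathcal{A}^{\dagger}\mathcal{P}_{\mathcal{R}(P)},$$ i.e. $A_{ML}^{\dagger}b=\mathcal{A}^{\dagger}(\mathcal{P}_{\mathcal{R}(P)}b)$ for every $b\in\mathbb{R}^m$.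
   Context: $\mathcal{R}(\cdot)$ and $\mathcal{N}(\cdot)$ denote range and null space; $\mathcal{P}_{\mathcal{S}}$ is the Euclidean orthogonal projector onto a subspace $\mathcal{S}$; for a matrix, $\dagger$ is the usual Moore-Penrose pseudoinverse. The $ML$-weighted pseudoinverse of $A$ is the matrix $$A_{ML}^{\dagger}:=(I_n-(L\mathcal{P}_{\mathcal{N}(MA)})^{\dagger}L)(MA)^{\dagger}M\in\mathbb{R}^{n\times m}.$$ For symmetric positive semidefinite $C$, $\langle x,x'\rangle_C=x^{\top}Cx'$, which is an inner product on $\mathcal{R}(C)$. $\mathcal{A}^{\dagger}$ is the Moore-Penrose pseudoinverse of $\mathcal{A}$ as an operator between these (finite-dimensional) Hilbert spaces: it is the linear extension of the inverse of $\mathcal{A}|_{\mathcal{N}(\mathcal{A})^{\perp}}:\mathcal{N}(\mathcal{A})^{\perp}\to\mathcal{R}(\mathcal{A})$ with $\mathcal{N}(\mathcal{A}^{\dagger})=\mathcal{R}(\mathcal{A})^{\perp}$, orthogonal complements being taken with respect to $\langle\cdot,\cdot\rangle_G$ and $\langle\cdot,\cdot\rangle_P$ respectively. *)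

theory Defs
  imports "HOL-Analysis.Analysis"
begin

definition null_space :: "real^'n^'m \<Rightarrow> (real^'n) set" where
  "null_space B = {x. B *v x = 0}"

definition range_space :: "real^'n^'m \<Rightarrow> (real^'m) set" where
  "range_space B = range ((*v) B)"

(* Meaningful only if S is a subspace. *)
definition orth_proj :: "'a::euclidean_space set \<Rightarrow> 'a \<Rightarrow> 'a" where
  "orth_proj S x = (THE y. y \<in> S \<and> x - y \<in> S\<^sup>\<bottom>)"

(* The four Penrose equations. *)
definition pinv :: "real^'n^'m \<Rightarrow> real^'m^'n" where
  "pinv B = (THE X. B ** X ** B = B \<and> X ** B ** X = X \<and>
                    transpose (B ** X) = B ** X \<and> transpose (X ** B) = X ** B)"

definition weighted_pinv :: "real^'n^'m \<Rightarrow> real^'m^'q \<Rightarrow> real^'n^'p \<Rightarrow> real^'m^'n" where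
  "weighted_pinv A M L =
     (mat 1 - pinv (L ** matrix (orth_proj (null_space (M ** A)))) ** L) ** pinv (M ** A) ** M"

definition weighted_inner :: "real^'n^'n \<Rightarrow> real^'n \<Rightarrow> real^'n \<Rightarrow> real" where
  "weighted_inner C x y = x \<bullet> (C *v y)"

(* Orthogonal complement of S inside the subspace X, for the inner product ip on X. *)
definition orth_compl_in :: "'a set \<Rightarrow> ('a \<Rightarrow> 'a \<Rightarrow> real) \<Rightarrow> 'a set \<Rightarrow> 'a set" where
  "orth_compl_in X ip S = {x \<in> X. \<forall>s\<in>S. ip s x = 0}"

(* Moore-Penrose pseudoinverse of a linear operator T from (X, ipX) to (Y, ipY), where X and Y are
   subspaces carrying the inner products ipX and ipY. Only the values of T on X matter. The
   pseudoinverse is a function on Y; extensional Y fixes it (as undefined) outside Y, so that the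
   description is unique. *)
definition op_pinv ::
  "'a::real_vector set \<Rightarrow> ('a \<Rightarrow> 'a \<Rightarrow> real) \<Rightarrow> 'b::real_vector set \<Rightarrow> ('b \<Rightarrow> 'b \<Rightarrow> real) \<Rightarrow>
   ('a \<Rightarrow> 'b) \<Rightarrow> 'b \<Rightarrow> 'a" where
  "op_pinv X ipX Y ipY T =
     (THE B. B \<in> extensional Y \<and> B \<in> Y \<rightarrow> X \<and>
             (\<forall>y\<in>Y. \<forall>z\<in>Y. B (y + z) = B y + B z) \<and>
             (\<forall>c. \<forall>y\<in>Y. B (c *\<^sub>R y) = c *\<^sub>R B y) \<and>
             (\<forall>v \<in> orth_compl_in X ipX {x \<in> X. T x = 0}. B (T v) = v) \<and>
             {y \<in> Y. B y = 0} = orth_compl_in Y ipY (T ` X))"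

end

theory Submission
  imports Defs
begin

text \<open>
  The pseudoinverse of \<open>\<A>\<close> sends \<open>y\<close> to the \<open>G\<close>-minimal least-squares solution, i.e. to the unique
  \<open>x \<in> \<R>(G)\<close> that is \<open>G\<close>-orthogonal to \<open>\<N>(\<A>)\<close> and whose residual \<open>y - \<A> x\<close> is \<open>P\<close>-orthogonal to the
  range of \<open>\<A>\<close>. Put \<open>w = (MA)\<^sup>\<dagger>Mb\<close>, let \<open>K = \<N>(MA)\<close> with orthogonal projector \<open>P\<^sub>K\<close>, and let
  \<open>u = (LP\<^sub>K)\<^sup>\<dagger>Lw\<close>, so that the weighted pseudoinverse yields \<open>x = w - u\<close>. As \<open>u \<in> K\<close>, the residual
  condition is the one for \<open>(MA)\<^sup>\<dagger>\<close>. On \<open>K\<close> the form \<open>G\<close> reduces to \<open>L\<^sup>TL\<close>, and \<open>Lx = Lw - LP\<^sub>Ku\<close> is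
  orthogonal to \<open>L(K)\<close>. Finally \<open>w\<close> and \<open>u\<close> are both orthogonal to \<open>K \<inter> \<N>(L) = \<N>(G)\<close>, so
  \<open>x \<in> \<R>(G)\<close>.
\<close>

section \<open>Orthogonal projectors onto subspaces\<close>

lemma orth_proj_eqI:
  fixes S :: "'a::euclidean_space set"
  assumes S: "subspace S" and y: "y \<in> S" "x - y \<in> S\<^sup>\<bottom>"
  shows "orth_proj S x = y"
  unfolding orth_proj_def
proof (rule the_equality)
  fix z assume z: "z \<in> S \<and> x - z \<in> S\<^sup>\<bottom>"
  have "z - y \<in> S"
    using S y z by (simp add: subspace_diff)
  moreover have "(x - y) - (x - z) \<in> S\<^sup>\<bottom>"
    using y z subspace_orthogonal_comp subspace_diff by blast
  ultimately have "(z - y) \<bullet> (z - y) = 0"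
    by (simp add: orthogonal_comp_def orthogonal_def)
  then show "z = y" by simp
qed (use y in simp)

lemma
  fixes S :: "'a::euclidean_space set"
  assumes S: "subspace S"
  shows orth_proj_in: "orth_proj S x \<in> S"
    and orth_proj_residual: "x - orth_proj S x \<in> S\<^sup>\<bottom>"
proof -
  obtain y z where "y \<in> span S" "\<And>w. w \<in> span S \<Longrightarrow> orthogonal z w" "x = y + z"
    using orthogonal_subspace_decomp_exists by blast
  moreover have "span S = S" using S by simp
  ultimately have y: "y \<in> S" "x - y \<in> S\<^sup>\<bottom>"
    by (auto simp: orthogonal_comp_def orthogonal_commute)
  then have "orth_proj S x = y"
    using S orth_proj_eqI by blast
  with y show "orth_proj S x \<in> S" "x - orth_proj S x \<in> S\<^sup>\<bottom>" by auto
qed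

lemma orth_proj_id:
  assumes "subspace S" "x \<in> S"
  shows "orth_proj S x = x"
  using assms by (intro orth_proj_eqI) (auto simp: orthogonal_comp_def orthogonal_def)

lemma linear_orth_proj:
  assumes S: "subspace S"
  shows "linear (orth_proj S)"
proof
  fix x y :: 'a and c :: real
  note C = subspace_orthogonal_comp[of S]
  have "(x - orth_proj S x) + (y - orth_proj S y) \<in> S\<^sup>\<bottom>"
    by (intro subspace_add C orth_proj_residual S)
  then show "orth_proj S (x + y) = orth_proj S x + orth_proj S y"
    by (intro orth_proj_eqI subspace_add orth_proj_in S) (simp add: algebra_simps)
  have "c *\<^sub>R (x - orth_proj S x) \<in> S\<^sup>\<bottom>"
    by (intro subspace_scale C orth_proj_residual S)
  then show "orth_proj S (c *\<^sub>R x) = c *\<^sub>R orth_proj S x"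
    by (intro orth_proj_eqI subspace_scale orth_proj_in S) (simp add: algebra_simps)
qed

text \<open>The residual of \<open>y\<close> is orthogonal to \<open>S\<close>. The right-hand side
  is symmetric in \<open>x\<close> and \<open>y\<close>, which yields self-adjointness of the
  projector.\<close>

lemma inner_orth_proj_left:
  assumes S: "subspace S"
  shows "orth_proj S x \<bullet> y = orth_proj S x \<bullet> orth_proj S y"
  using orth_proj_in[OF S, of x] orth_proj_residual[OF S, of y]
  by (simp add: orthogonal_comp_def orthogonal_def inner_diff_right)

lemma matrix_orth_proj:
  fixes S :: "(real^'n) set"
  assumes "subspace S"
  shows "matrix (orth_proj S) *v x = orth_proj S x"
  using matrix_vector_mul(2)[OF linear_orth_proj[OF assms]] by metis

lemma inner_transpose_left:
  fixes B :: "real^'n^'m"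
  shows "(transpose B *v x) \<bullet> y = x \<bullet> (B *v y)"
  by (simp add: dot_lmul_matrix)

lemma transpose_matrix_orth_proj:
  fixes S :: "(real^'n) set"
  assumes S: "subspace S"
  shows "transpose (matrix (orth_proj S)) = matrix (orth_proj S)"
proof -
  have "(transpose (matrix (orth_proj S)) *v x) \<bullet> y = (matrix (orth_proj S) *v x) \<bullet> y" for x y
    unfolding inner_transpose_left matrix_orth_proj[OF S]
    by (metis S inner_commute inner_orth_proj_left)
  then show ?thesis
    by (metis matrix_eq vector_eq_rdot)
qed

section \<open>Null spaces and ranges as orthogonal complements\<close>

lemma subspace_null_space: "subspace (null_space B)"
  by (auto simp: null_space_def subspace_def matrix_vector_right_distrib matrix_vector_mult_scaleR)

lemma subspace_range_space: "subspace (range_space B)"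
  unfolding range_space_def by (rule linear_subspace_image) (auto simp: matrix_vector_mul_linear)

lemma orthogonal_comp_range_space: "(range_space B)\<^sup>\<bottom> = null_space (transpose B)"
proof -
  have "(\<forall>y. orthogonal (B *v y) x) \<longleftrightarrow> transpose B *v x = 0" for x
    by (auto simp: orthogonal_def inner_commute[of "B *v _"] simp flip: inner_transpose_left)
  then show ?thesis
    by (auto simp: orthogonal_comp_def range_space_def null_space_def)
qed

lemma range_space_transpose: "range_space (transpose B) = (null_space B)\<^sup>\<bottom>"
  by (metis orthogonal_comp_range_space orthogonal_comp_self subspace_range_space transpose_transpose)

section \<open>The Moore-Penrose inverse of a matrix\<close>

lemma penrose_unique:
  fixes B :: "real^'n^'m"
  assumes X: "B ** X ** B = B" "X ** B ** X = X"
      "transpose (B ** X) = B ** X" "transpose (X ** B) = X ** B"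
    and Y: "B ** Y ** B = B" "Y ** B ** Y = Y"
      "transpose (B ** Y) = B ** Y" "transpose (Y ** B) = Y ** B"
  shows "X = Y"
proof -
  \<comment> \<open>\<open>B ** X\<close> and \<open>B ** Y\<close> are symmetric idempotents with
    the same range, so each absorbs the other; transposing the product exchanges the two
    absorptions.\<close>
  have "B ** X = (B ** Y) ** (B ** X)"
    by (metis Y(1) matrix_mul_assoc)
  also have "\<dots> = transpose ((B ** X) ** (B ** Y))"
    by (simp only: matrix_transpose_mul[of "B ** X"] X(3) Y(3))
  also have "\<dots> = B ** Y"
    by (metis X(1) Y(3) matrix_mul_assoc)
  finally have 1: "B ** X = B ** Y" .
  have "X ** B = (X ** B) ** (Y ** B)"
    by (metis Y(1) matrix_mul_assoc)
  also have "\<dots> = transpose ((Y ** B) ** (X ** B))"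
    by (simp only: matrix_transpose_mul[of "Y ** B"] X(4) Y(4))
  also have "\<dots> = Y ** B"
    by (metis X(1) Y(4) matrix_mul_assoc)
  finally have 2: "X ** B = Y ** B" .
  show ?thesis
    by (metis 1 2 X(2) Y(2) matrix_mul_assoc)
qed

text \<open>The pseudoinverse inverts \<open>B\<close> on the row space, after projecting onto the column space.\<close>

lemma penrose_exists:
  fixes B :: "real^'n^'m"
  shows "\<exists>X. B ** X ** B = B \<and> X ** B ** X = X \<and>
    transpose (B ** X) = B ** X \<and> transpose (X ** B) = X ** B"
proof -
  let ?V = "(null_space B)\<^sup>\<bottom>" and ?R = "range_space B"
  note V = subspace_orthogonal_comp[of "null_space B"] and R = subspace_range_space[of B]
  have "inj_on ((*v) B) ?V"
  proof (rule inj_onI)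
    fix x y assume "x \<in> ?V" "y \<in> ?V" and "B *v x = B *v y"
    then have "x - y \<in> ?V" "x - y \<in> null_space B"
      by (simp_all add: subspace_diff[OF V])
         (simp add: null_space_def matrix_vector_mult_diff_distrib)
    then have "orthogonal (x - y) (x - y)"
      by (auto simp: orthogonal_comp_def)
    then show "x = y" by (simp add: orthogonal_self)
  qed
  \<comment> \<open>The range condition on \<open>g\<close> keeps all values of \<open>X\<close> in
    \<open>?V\<close>, which later gives \<open>X ** B ** X = X\<close>.\<close>
  then obtain g where gV: "range g \<subseteq> ?V" and lin: "linear g"
    and g: "\<And>v. v \<in> ?V \<Longrightarrow> g (B *v v) = v"
    using linear_exists_left_inverse_on[OF matrix_vector_mul_linear V] by blast
  have B: "B *v orth_proj ?V x = B *v x" for x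
  proof -
    have "x - orth_proj ?V x \<in> null_space B"
      using orth_proj_residual[OF V] orthogonal_comp_self[OF subspace_null_space] by metis
    then show ?thesis
      by (simp add: null_space_def matrix_vector_mult_diff_distrib)
  qed
  have RB: "orth_proj ?R (B *v x) = B *v x" for x
    by (rule orth_proj_id[OF R]) (simp add: range_space_def)
  define X where "X = matrix (g \<circ> orth_proj ?R)"
  have X: "X *v b = g (orth_proj ?R b)" for b
    using matrix_vector_mul(2)[OF linear_compose[OF linear_orth_proj[OF R] lin]]
    unfolding X_def by (metis comp_apply)
  \<comment> \<open>Once both products are known to be orthogonal projectors, the symmetry equations
    are automatic, and the other two say that the projectors fix \<open>X\<close> and
    \<open>B\<close>.\<close>
  have "X ** B = matrix (orth_proj ?V)"
  proof -
    have "X *v (B *v x) = orth_proj ?V x" for x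
    proof -
      have "orth_proj ?R (B *v x) = B *v orth_proj ?V x"
        by (simp add: B RB)
      then show ?thesis
        by (simp add: X g orth_proj_in[OF V])
    qed
    then show ?thesis
      by (simp add: matrix_eq matrix_orth_proj[OF V] flip: matrix_vector_mul_assoc)
  qed
  moreover have "B ** X = matrix (orth_proj ?R)"
  proof -
    have "B *v (X *v b) = orth_proj ?R b" for b
    proof -
      obtain x where "orth_proj ?R b = B *v x"
        using orth_proj_in[OF R, of b] by (auto simp: range_space_def)
      then have "orth_proj ?R b = B *v orth_proj ?V x"
        by (simp add: B)
      then show ?thesis
        by (simp add: X g orth_proj_in[OF V])
    qed
    then show ?thesis
      by (simp add: matrix_eq matrix_orth_proj[OF R] flip: matrix_vector_mul_assoc)
  qed
  moreover have "matrix (orth_proj ?R) ** B = B"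
    by (simp add: matrix_eq matrix_orth_proj[OF R] RB flip: matrix_vector_mul_assoc)
  moreover have "matrix (orth_proj ?V) ** X = X"
    using gV by (auto simp: matrix_eq matrix_orth_proj[OF V] orth_proj_id[OF V] X image_subset_iff
        simp flip: matrix_vector_mul_assoc)
  ultimately show ?thesis
    by (intro exI[of _ X]) (simp add: transpose_matrix_orth_proj V R)
qed

lemma
  fixes B :: "real^'n^'m"
  shows pinv_mult_1: "B ** pinv B ** B = B"
    and pinv_mult_2: "pinv B ** B ** pinv B = pinv B"
    and pinv_symmetric_1: "transpose (B ** pinv B) = B ** pinv B"
    and pinv_symmetric_2: "transpose (pinv B ** B) = pinv B ** B"
proof -
  have "\<exists>!X. B ** X ** B = B \<and> X ** B ** X = X \<and>
    transpose (B ** X) = B ** X \<and> transpose (X ** B) = X ** B"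
    using penrose_exists penrose_unique by (intro ex_ex1I) (blast, blast)
  from theI'[OF this, folded pinv_def]
  show "B ** pinv B ** B = B" "pinv B ** B ** pinv B = pinv B"
    "transpose (B ** pinv B) = B ** pinv B" "transpose (pinv B ** B) = pinv B ** B"
    by auto
qed

text \<open>Least-squares property: \<open>B ** pinv B\<close> is symmetric and fixes
  \<open>B *v x\<close>, so it can be moved across the inner product.\<close>

lemma pinv_residual_orthogonal:
  fixes B :: "real^'n^'m"
  shows "(B *v x) \<bullet> (b - B *v (pinv B *v b)) = 0"
proof -
  have "(B *v x) \<bullet> (B *v (pinv B *v b)) = (transpose (B ** pinv B) *v (B *v x)) \<bullet> b"
    unfolding inner_transpose_left by (simp only: matrix_vector_mul_assoc)
  also have "\<dots> = (B *v x) \<bullet> b"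
    by (simp add: pinv_symmetric_1 pinv_mult_1 matrix_vector_mul_assoc)
  finally show ?thesis by (simp add: inner_diff_right)
qed

text \<open>Minimum-norm property: the symmetric matrix \<open>pinv B ** B\<close> fixes the values
  of \<open>pinv B\<close> and annihilates \<open>z\<close>.\<close>

lemma inner_pinv_null_space:
  fixes B :: "real^'n^'m"
  assumes "B *v z = 0"
  shows "z \<bullet> (pinv B *v b) = 0"
proof -
  have "z \<bullet> (pinv B *v b) = z \<bullet> (transpose (pinv B ** B) *v (pinv B *v b))"
    by (simp add: pinv_symmetric_2 pinv_mult_2 matrix_vector_mul_assoc)
  also have "\<dots> = ((pinv B ** B) *v z) \<bullet> (pinv B *v b)"
    by (metis inner_commute inner_transpose_left)
  also have "\<dots> = 0"
    by (simp add: assms flip: matrix_vector_mul_assoc)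
  finally show ?thesis .
qed

section \<open>Characterization of the operator pseudoinverse\<close>

text \<open>
  \<open>W y\<close> is the minimum-norm least-squares solution of \<open>T x = y\<close>; this property alone
  determines the pseudoinverse.
\<close>

lemma op_pinv_eqI:
  assumes T: "T \<in> X \<rightarrow> Y" and T_diff: "\<And>u v. u \<in> X \<Longrightarrow> v \<in> X \<Longrightarrow> T (u - v) = T u - T v"
    and X: "subspace X" and Y: "subspace Y"
    and ipX_diff: "\<And>x y z. ipX x (y - z) = ipX x y - ipX x z"
    and ipY_diff: "\<And>x y z. ipY x (y - z) = ipY x y - ipY x z"
    and ipX_definite: "\<And>x. x \<in> X \<Longrightarrow> ipX x x = 0 \<Longrightarrow> x = 0"
    and ipY_definite: "\<And>y. y \<in> Y \<Longrightarrow> ipY y y = 0 \<Longrightarrow> y = 0"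
    and W_add: "\<And>y z. y \<in> Y \<Longrightarrow> z \<in> Y \<Longrightarrow> W (y + z) = W y + W z"
    and W_scale: "\<And>c y. y \<in> Y \<Longrightarrow> W (c *\<^sub>R y) = c *\<^sub>R W y"
    and W_min: "\<And>y. y \<in> Y \<Longrightarrow> W y \<in> orth_compl_in X ipX {x \<in> X. T x = 0}"
    and W_lsq: "\<And>y. y \<in> Y \<Longrightarrow> y - T (W y) \<in> orth_compl_in Y ipY (T ` X)"
    and y: "y \<in> Y"
  shows "op_pinv X ipX Y ipY T y = W y"
proof -
  let ?N = "orth_compl_in X ipX {x \<in> X. T x = 0}" and ?R = "orth_compl_in Y ipY (T ` X)"
  have WX: "W z \<in> X" if "z \<in> Y" for z
    using W_min[OF that] by (simp add: orth_compl_in_def)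
  have TY: "T v \<in> Y" if "v \<in> X" for v
    using T that by blast
  have T0: "T 0 = 0"
    using T_diff[of 0 0] X by (simp add: subspace_0)
  \<comment> \<open>\<open>T v\<close> lies in the range of \<open>T\<close> and in its complement,
    hence is orthogonal to itself.\<close>
  have range_zero: "T v = 0" if "v \<in> X" "T v \<in> ?R" for v
    using that by (auto simp: orth_compl_in_def intro: ipY_definite)
  have min_zero: "v = 0" if "v \<in> ?N" "T v = 0" for v
    using that by (auto simp: orth_compl_in_def intro: ipX_definite)
  have N_diff: "u - v \<in> ?N" if "u \<in> ?N" "v \<in> ?N" for u v
    using that X by (auto simp: orth_compl_in_def ipX_diff subspace_diff)
  have R_diff: "u - v \<in> ?R" if "u \<in> ?R" "v \<in> ?R" for u v
    using that Y by (auto simp: orth_compl_in_def ipY_diff subspace_diff)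
  \<comment> \<open>The description of \<open>op_pinv\<close> demands membership in
    \<open>extensional Y\<close>, which \<open>W\<close> need not have.\<close>
  define W' where "W' = restrict W Y"
  have inv: "W (T v) = v" if v: "v \<in> ?N" for v
  proof -
    have vX: "v \<in> X" using v by (simp add: orth_compl_in_def)
    let ?d = "v - W (T v)"
    have dX: "?d \<in> X" and Td: "T ?d = T v - T (W (T v))"
      using vX by (auto simp: X WX TY subspace_diff T_diff)
    have "T ?d = 0"
      using range_zero[OF dX] W_lsq[of "T v"] Td TY[OF vX] by simp
    moreover have "?d \<in> ?N"
      using v W_min TY[OF vX] by (intro N_diff) auto
    ultimately have "?d = 0" by (intro min_zero)
    then show ?thesis by simp
  qed
  have ker: "W z = 0 \<longleftrightarrow> z \<in> ?R" if z: "z \<in> Y" for z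
  proof
    assume "W z = 0" then show "z \<in> ?R" using W_lsq[OF z] T0 by simp
  next
    assume "z \<in> ?R"
    then have "T (W z) \<in> ?R"
      using R_diff[OF _ W_lsq[OF z], of z] by simp
    then show "W z = 0"
      using range_zero min_zero WX W_min z by blast
  qed
  have "op_pinv X ipX Y ipY T = W'"
    unfolding op_pinv_def
  proof (rule the_equality, intro conjI)
    show "W' \<in> Y \<rightarrow> X" using WX by (simp add: W'_def)
    show "\<forall>y\<in>Y. \<forall>z\<in>Y. W' (y + z) = W' y + W' z"
      using Y by (simp add: W'_def W_add subspace_add)
    show "\<forall>c. \<forall>y\<in>Y. W' (c *\<^sub>R y) = c *\<^sub>R W' y"
      using Y by (simp add: W'_def W_scale subspace_scale)
    show "\<forall>v\<in>?N. W' (T v) = v"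
      using inv TY by (simp add: W'_def orth_compl_in_def)
    have "?R \<subseteq> Y" by (auto simp: orth_compl_in_def)
    then show "{y \<in> Y. W' y = 0} = ?R"
      using ker by (auto simp: W'_def)
  next
    fix B assume B: "B \<in> extensional Y \<and> B \<in> Y \<rightarrow> X \<and>
             (\<forall>y\<in>Y. \<forall>z\<in>Y. B (y + z) = B y + B z) \<and>
             (\<forall>c. \<forall>y\<in>Y. B (c *\<^sub>R y) = c *\<^sub>R B y) \<and>
             (\<forall>v \<in> ?N. B (T v) = v) \<and>
             {y \<in> Y. B y = 0} = ?R"
    show "B = W'"
    proof (rule extensionalityI[of _ Y])
      fix z assume z: "z \<in> Y"
      have r: "z - T (W z) \<in> Y" "B (z - T (W z)) = 0"
        using B W_lsq[OF z] by blast+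
      \<comment> \<open>The residual is killed by the kernel condition on \<open>B\<close>, while
        \<open>W z\<close> lies in \<open>?N\<close>, where \<open>B\<close> inverts
        \<open>T\<close>.\<close>
      have "B z = B ((z - T (W z)) + T (W z))" by simp
      also have "\<dots> = B (z - T (W z)) + B (T (W z))"
        using B r TY[OF WX[OF z]] by blast
      also have "\<dots> = W z"
        using B r W_min[OF z] by simp
      finally show "B z = W' z" using z by (simp add: W'_def)
    qed (use B in \<open>auto simp: W'_def\<close>)
  qed (simp add: W'_def)
  then show ?thesis using y by (simp add: W'_def)
qed

section \<open>Weighted inner products and Gram matrices\<close>

lemma weighted_inner_diff_right:
  "weighted_inner C x (y - z) = weighted_inner C x y - weighted_inner C x z"
  by (simp add: weighted_inner_def matrix_vector_mult_diff_distrib inner_diff_right)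

lemma inner_gram:
  fixes B :: "real^'n^'m"
  shows "x \<bullet> ((transpose B ** B) *v y) = (B *v x) \<bullet> (B *v y)"
proof -
  have "x \<bullet> ((transpose B ** B) *v y) = (transpose B *v (B *v y)) \<bullet> x"
    by (simp only: inner_commute flip: matrix_vector_mul_assoc)
  also have "\<dots> = (B *v x) \<bullet> (B *v y)"
    unfolding inner_transpose_left by (rule inner_commute)
  finally show ?thesis .
qed

lemma null_space_gram:
  fixes B :: "real^'n^'m"
  shows "null_space (transpose B ** B) = null_space B"
proof -
  have "B *v x = 0" if "(transpose B ** B) *v x = 0" for x
    using inner_gram[of x B x] that by simp
  then show ?thesis
    by (auto simp: null_space_def simp flip: matrix_vector_mul_assoc)
qed

lemma range_space_symmetric:
  assumes "transpose B = B"
  shows "range_space B = (null_space B)\<^sup>\<bottom>"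
  using range_space_transpose[of B] assms by simp

section \<open>Optimality properties of the weighted pseudoinverse\<close>

context
  fixes A :: "real^'n^'m" and M :: "real^'m^'q" and L :: "real^'n^'p" and b :: "real^'m"
begin

private abbreviation "K \<equiv> null_space (M ** A)"
private abbreviation "LK \<equiv> L ** matrix (orth_proj K)"
private abbreviation "w \<equiv> pinv (M ** A) *v (M *v b)"
private abbreviation "u \<equiv> pinv LK *v (L *v w)"

private lemma weighted_pinv_apply: "weighted_pinv A M L *v b = w - u"
  by (simp add: weighted_pinv_def matrix_vector_mult_diff_rdistrib flip: matrix_vector_mul_assoc)

private lemma LK_apply: "LK *v x = L *v orth_proj K x"
  by (simp add: matrix_orth_proj subspace_null_space flip: matrix_vector_mul_assoc)

text \<open>\<open>LK\<close> vanishes on the complement of \<open>K\<close>, so \<open>u\<close>, a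
  value of \<open>pinv LK\<close>, is orthogonal to that complement and lies in the double
  complement, which is \<open>K\<close>.\<close>

private lemma correction_in_null_space: "(M ** A) *v u = 0"
proof -
  have "z \<bullet> u = 0" if "z \<in> K\<^sup>\<bottom>" for z
  proof -
    have "orth_proj K z = 0"
      using that by (intro orth_proj_eqI) (auto simp: subspace_null_space subspace_0)
    then have "LK *v z = 0" by (simp add: LK_apply)
    then show ?thesis by (rule inner_pinv_null_space)
  qed
  then have "u \<in> K\<^sup>\<bottom>\<^sup>\<bottom>"
    unfolding orthogonal_comp_def[of "K\<^sup>\<bottom>"] by (simp add: orthogonal_def)
  then show ?thesis
    by (simp add: orthogonal_comp_self subspace_null_space) (simp add: null_space_def)
qed

lemma weighted_pinv_residual_orthogonal:
  "((M ** A) *v v) \<bullet> (M *v b - (M ** A) *v (weighted_pinv A M L *v b)) = 0"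
  unfolding weighted_pinv_apply
  by (simp add: matrix_vector_mult_diff_distrib correction_in_null_space pinv_residual_orthogonal)

text \<open>Both \<open>v\<close> and \<open>u\<close> are fixed by the projector onto
  \<open>K\<close>, so \<open>L *v (w - u)\<close> is the least-squares residual of
  \<open>LK\<close> for the right-hand side \<open>L *v w\<close>.\<close>

lemma weighted_pinv_L_orthogonal:
  assumes "(M ** A) *v v = 0"
  shows "(L *v v) \<bullet> (L *v (weighted_pinv A M L *v b)) = 0"
proof -
  have K: "orth_proj K x = x" if "(M ** A) *v x = 0" for x
    using that by (intro orth_proj_id subspace_null_space) (simp add: null_space_def)
  have "(LK *v v) \<bullet> (L *v w - LK *v u) = 0"
    by (rule pinv_residual_orthogonal)
  then show ?thesis
    by (simp add: LK_apply K assms correction_in_null_space weighted_pinv_apply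
        matrix_vector_mult_diff_distrib)
qed

lemma weighted_pinv_orthogonal_null_spaces:
  assumes "(M ** A) *v z = 0" "L *v z = 0"
  shows "z \<bullet> (weighted_pinv A M L *v b) = 0"
proof -
  have "orth_proj K z = z"
    using assms by (intro orth_proj_id subspace_null_space) (simp add: null_space_def)
  then have "LK *v z = 0" by (simp add: LK_apply assms)
  then show ?thesis
    by (simp add: weighted_pinv_apply inner_diff_right inner_pinv_null_space assms)
qed

end

section \<open>Identification with the operator pseudoinverse\<close>

theorem theorem3p6:
  fixes A :: "real^'n^'m" and M :: "real^'m^'q" and L :: "real^'n^'p"
    and P :: "real^'m^'m" and Q G :: "real^'n^'n"
    and \<A> :: "real^'n \<Rightarrow> real^'m"
  assumes "P = transpose M ** M"
    and "Q = transpose L ** L"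
    and "G = transpose A ** P ** A + Q"
    and "\<And>v. v \<in> range_space G \<Longrightarrow> \<A> v = orth_proj (range_space P) (A *v v)"
  shows "\<forall>b. weighted_pinv A M L *v b =
             op_pinv (range_space G) (weighted_inner G) (range_space P) (weighted_inner P) \<A>
               (orth_proj (range_space P) b)"
proof
  fix b
  let ?X = "range_space G" and ?Y = "range_space P" and ?W = "weighted_pinv A M L"
  note X = subspace_range_space[of G] and Y = subspace_range_space[of P]
  have G: "G = transpose (M ** A) ** (M ** A) + transpose L ** L"
    by (simp add: assms matrix_transpose_mul matrix_mul_assoc)
  have ipP: "weighted_inner P x y = (M *v x) \<bullet> (M *v y)" for x y
    by (simp add: weighted_inner_def assms inner_gram)
  have ipG: "weighted_inner G x y =
      ((M ** A) *v x) \<bullet> ((M ** A) *v y) + (L *v x) \<bullet> (L *v y)" for x y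
    unfolding weighted_inner_def G
    by (simp only: matrix_vector_mult_add_rdistrib inner_add_right inner_gram)
  have "transpose P = P"
    by (simp add: assms matrix_transpose_mul)
  then have rangeP: "?Y = (null_space M)\<^sup>\<bottom>"
    by (simp add: range_space_symmetric) (simp add: assms null_space_gram)
  have symG: "transpose G = G"
    by (simp add: G matrix_transpose_mul transpose_def vec_eq_iff matrix_matrix_mult_def mult.commute)
  have ipG0: "(M ** A) *v x = 0 \<and> L *v x = 0" if "weighted_inner G x x = 0" for x
    using that by (simp add: ipG add_nonneg_eq_0_iff)
  have rangeG: "?X = (null_space G)\<^sup>\<bottom>"
    by (rule range_space_symmetric[OF symG])
  \<comment> \<open>The part removed by projecting onto the range of \<open>P\<close> lies in the
    null space of \<open>M\<close>.\<close>
  have M_proj: "M *v orth_proj ?Y y = M *v y" for y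
  proof -
    have "y - orth_proj ?Y y \<in> null_space M"
      using orth_proj_residual[OF Y, of y]
      by (simp add: rangeP orthogonal_comp_self subspace_null_space)
    then show ?thesis
      by (simp add: null_space_def matrix_vector_mult_diff_distrib)
  qed
  have definiteP: "y = 0" if "y \<in> ?Y" "M *v y = 0" for y
    using that by (simp add: rangeP orthogonal_comp_def orthogonal_def null_space_def)
                  (metis inner_eq_zero_iff)
  have definiteG: "x = 0" if "x \<in> ?X" "weighted_inner G x x = 0" for x
  proof -
    have "G *v x = 0"
      using ipG0[OF that(2)]
      by (simp add: G matrix_vector_mult_add_rdistrib flip: matrix_vector_mul_assoc)
    then show ?thesis
      using that(1) by (simp add: rangeG orthogonal_comp_def orthogonal_def null_space_def)
                       (metis inner_eq_zero_iff)
  qed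
  have MA: "M *v \<A> v = (M ** A) *v v" if "v \<in> ?X" for v
    using that by (simp add: assms(4) M_proj matrix_vector_mul_assoc)
  \<comment> \<open>Membership is tested against the null space of \<open>G\<close>: there the
    \<open>G\<close>-form vanishes, and with it both \<open>M ** A\<close> and
    \<open>L\<close>.\<close>
  have W_in: "?W *v y \<in> ?X" for y
  proof -
    have "z \<bullet> (?W *v y) = 0" if "G *v z = 0" for z
    proof -
      have "weighted_inner G z z = 0" using that by (simp add: weighted_inner_def)
      then show ?thesis
        using ipG0 weighted_pinv_orthogonal_null_spaces by blast
    qed
    then show ?thesis
      by (simp add: rangeG orthogonal_comp_def orthogonal_def null_space_def)
  qed
  have "op_pinv ?X (weighted_inner G) ?Y (weighted_inner P) \<A> y = ?W *v y" if "y \<in> ?Y" for y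
  proof (rule op_pinv_eqI)
    show in_Y: "\<A> \<in> ?X \<rightarrow> ?Y"
      by (simp add: assms(4) orth_proj_in[OF Y])
    show "\<A> (u - v) = \<A> u - \<A> v" if "u \<in> ?X" "v \<in> ?X" for u v
      using that by (simp add: assms(4) subspace_diff[OF X] matrix_vector_mult_diff_distrib
          linear_diff[OF linear_orth_proj[OF Y]])
    show "?W *v y \<in> orth_compl_in ?X (weighted_inner G) {x \<in> ?X. \<A> x = 0}" for y
    proof -
      \<comment> \<open>The first summand of the \<open>G\<close>-form vanishes, since
        \<open>M\<close> applied to \<open>\<A> x\<close> equals \<open>(M ** A) *v x\<close>; only
        the \<open>L\<close> part is left.\<close>
      have "weighted_inner G x (?W *v y) = 0" if "x \<in> ?X" "\<A> x = 0" for x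
        using MA[OF that(1)] that(2) by (simp add: ipG weighted_pinv_L_orthogonal)
      then show ?thesis by (simp add: orth_compl_in_def W_in)
    qed
    show "y - \<A> (?W *v y) \<in> orth_compl_in ?Y (weighted_inner P) (\<A> ` ?X)" if "y \<in> ?Y" for y
    proof -
      have "\<A> (?W *v y) \<in> ?Y" using in_Y W_in by blast
      then show ?thesis
        using that by (auto simp: orth_compl_in_def subspace_diff[OF Y] ipP MA W_in
            matrix_vector_mult_diff_distrib weighted_pinv_residual_orthogonal)
    qed
  qed (use that X Y definiteG definiteP in \<open>auto simp: weighted_inner_diff_right ipP
      matrix_vector_right_distrib matrix_vector_mult_scaleR\<close>)
  \<comment> \<open>The rightmost factor of the weighted pseudoinverse is \<open>M\<close>, which
    does not see the projection.\<close>
  moreover have "?W *v orth_proj ?Y b = ?W *v b"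
    unfolding weighted_pinv_def by (simp add: M_proj flip: matrix_vector_mul_assoc)
  ultimately show "?W *v b =
      op_pinv ?X (weighted_inner G) ?Y (weighted_inner P) \<A> (orth_proj ?Y b)"
    by (simp add: orth_proj_in[OF Y])
qed

end
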